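(* Let $d>4$, let $F_d$ be the free group on generators $a_1,\ldots,a_d$, and let $\mu_d$ be the uniform probability measure on $\{a_1^{\pm1},\ldots,a_d^{\pm1}\}$. Then $(F_d,\mu_d)$ is not algebraically recurrent: there is $n$ such that with positive probability $\mathcal{S}_n\neq F_d$.
   Context: A $\mu$-random walk is $X_n=\zeta_1\cdots\zeta_n$ with $\zeta_i$ i.i.d. of law $\mu$; $\mathcal{S}_n$ denotes the semigroup generated by $\{X_n,X_{n+1},\ldots\}$. $(G,\mu)$ is algebraically recurrent if for every $n$, $\mathcal{S}_n=G$ almost surely. *)

theory Defs
  imports "HOL-Algebra.Group" "HOL-Probability.Probability"
begin

text \<open>A letter (i, b) stands for the generator a_i if b = True and for its inverse
  if b = False.\<close>
type_synonym letter = "nat \<times> bool"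

fun cancel_letter :: "letter \<Rightarrow> letter list \<Rightarrow> letter list" where
  "cancel_letter x [] = [x]"
| "cancel_letter x (y # ys) =
     (if fst x = fst y \<and> snd x \<noteq> snd y then ys else x # y # ys)"

definition reduce_word :: "letter list \<Rightarrow> letter list" where
  "reduce_word ws = foldr cancel_letter ws []"

definition reduced_word :: "letter list \<Rightarrow> bool" where
  "reduced_word ws \<longleftrightarrow>
     (\<forall>i. Suc i < length ws \<longrightarrow>
        \<not> (fst (ws ! i) = fst (ws ! Suc i) \<and> snd (ws ! i) \<noteq> snd (ws ! Suc i)))"

definition free_group :: "nat \<Rightarrow> letter list monoid" where
  "free_group d =
     \<lparr> partial_object.carrier = {ws. reduced_word ws \<and> (\<forall>x \<in> set ws. fst x < d)},
       monoid.mult = (\<lambda>xs ys. reduce_word (xs @ ys)),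
       monoid.one = [] \<rparr>"

definition mu_free :: "nat \<Rightarrow> letter list pmf" where
  "mu_free d = pmf_of_set {[(i, b)] | i b. i < d}"

inductive_set gen_semigroup :: "('a, 'b) monoid_scheme \<Rightarrow> 'a set \<Rightarrow> 'a set"
  for G A where
  gen: "a \<in> A \<Longrightarrow> a \<in> gen_semigroup G A"
| mult: "x \<in> gen_semigroup G A \<Longrightarrow> y \<in> gen_semigroup G A \<Longrightarrow>
           x \<otimes>\<^bsub>G\<^esub> y \<in> gen_semigroup G A"

text \<open>Position X_n = zeta_1 ... zeta_n of the random walk, where the increment
  zeta_(i+1) is \<omega> i.\<close>
definition rw_pos :: "('a, 'b) monoid_scheme \<Rightarrow> (nat \<Rightarrow> 'a) \<Rightarrow> nat \<Rightarrow> 'a" where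
  "rw_pos G \<omega> n = foldl (\<lambda>acc i. acc \<otimes>\<^bsub>G\<^esub> \<omega> i) \<one>\<^bsub>G\<^esub> [0..<n]"

definition rw_space :: "'a pmf \<Rightarrow> (nat \<Rightarrow> 'a) measure" where
  "rw_space \<mu> = Pi\<^sub>M UNIV (\<lambda>_. measure_pmf \<mu>)"

definition rw_tail_semigroup :: "('a, 'b) monoid_scheme \<Rightarrow> (nat \<Rightarrow> 'a) \<Rightarrow> nat \<Rightarrow> 'a set" where
  "rw_tail_semigroup G \<omega> n = gen_semigroup G {rw_pos G \<omega> m | m. n \<le> m}"

definition alg_recurrent :: "('a, 'b) monoid_scheme \<Rightarrow> 'a pmf \<Rightarrow> bool" where
  "alg_recurrent G \<mu> \<longleftrightarrow>
     (\<forall>n\<ge>1. AE \<omega> in rw_space \<mu>. rw_tail_semigroup G \<omega> n = carrier G)"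

end

theory Submission
  imports Defs
begin

text \<open>
  Write \<open>S\<close> for the semigroup generated by \<open>X m\<close>, \<open>m \<ge> 64 n\<^sub>0\<close>. For large \<open>n\<^sub>0\<close>, with positive
  probability every product \<open>X m \<cdot> s\<close> with \<open>s \<in> S\<close> cancels fewer than \<open>h = m div 64\<close> letters of
  \<open>X m\<close>, while \<open>X m\<close> has length at least \<open>m / 4\<close>; hence the identity is not in \<open>S\<close>.

  Since \<open>d > 4\<close>, the function \<open>3 ^ (- length (g \<cdot> X k))\<close> shrinks on average by the factor \<open>3/5\<close> per
  step. This gives linear escape, and shows that a segment of length \<open>k\<close> of the walk spells a given
  word of length \<open>h\<close> with probability at most \<open>(3/5) ^ k * 3 ^ (- h)\<close>. If \<open>s\<close> cancels \<open>h\<close> letters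
  of \<open>X m\<close>, then a segment of the walk between the times \<open>8 h\<close> and \<open>m\<close> spells the inverse of the
  prefix of \<open>s\<close> of length \<open>h\<close>. By induction on the number of factors this prefix is already a prefix
  of a product of positions with indices in \<open>[n\<^sub>0, 8 h]\<close> whose sum is at most \<open>16 h\<close>. These positions
  are independent of the segment, and for large \<open>n\<^sub>0\<close> there are at most \<open>2 * 2 ^ h\<close> such products, so
  the probabilities of these coincidences are summable over \<open>m\<close>.
\<close>

subsection \<open>Reduced words\<close>

definition inv_letter :: "letter \<Rightarrow> letter" where
  "inv_letter x = (fst x, \<not> snd x)"

lemma inv_letter_inv_letter [simp]: "inv_letter (inv_letter x) = x"
  by (simp add: inv_letter_def)

lemma inv_letter_eq_iff: "inv_letter x = y \<longleftrightarrow> x = inv_letter y"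
  by (metis inv_letter_inv_letter)

lemma opposite_letter_iff: "fst x = fst y \<and> snd x \<noteq> snd y \<longleftrightarrow> y = inv_letter x"
  by (cases x; cases y) (auto simp: inv_letter_def)

lemma cancel_letter_Cons:
  "cancel_letter x (y # ys) = (if y = inv_letter x then ys else x # y # ys)"
  by (simp only: cancel_letter.simps opposite_letter_iff)

declare cancel_letter.simps(2) [simp del] cancel_letter_Cons [simp]

lemma reduced_word_successively:
  "reduced_word ws \<longleftrightarrow> successively (\<lambda>x y. y \<noteq> inv_letter x) ws"
  unfolding reduced_word_def opposite_letter_iff successively_conv_nth by simp

lemma reduced_word_Nil [simp]: "reduced_word []"
  and reduced_word_singleton [simp]: "reduced_word [x]"
  and reduced_word_Cons_Cons [simp]:
    "reduced_word (x # y # ys) \<longleftrightarrow> y \<noteq> inv_letter x \<and> reduced_word (y # ys)"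
  by (simp_all add: reduced_word_successively)

lemma reduced_word_append_iff:
  "reduced_word (xs @ ys) \<longleftrightarrow> reduced_word xs \<and> reduced_word ys \<and>
     (xs \<noteq> [] \<longrightarrow> ys \<noteq> [] \<longrightarrow> hd ys \<noteq> inv_letter (last xs))"
  by (auto simp: reduced_word_successively successively_append_iff)

lemma reduced_word_ConsD: "reduced_word (x # xs) \<Longrightarrow> reduced_word xs"
  using reduced_word_append_iff[of "[x]" xs] by simp

lemma reduced_word_cancel_letter: "reduced_word ys \<Longrightarrow> reduced_word (cancel_letter x ys)"
  by (cases ys) (auto dest: reduced_word_ConsD)

lemma reduced_word_foldr: "reduced_word ys \<Longrightarrow> reduced_word (foldr cancel_letter xs ys)"
  by (induction xs) (auto intro: reduced_word_cancel_letter)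

lemma reduced_word_reduce_word [simp]: "reduced_word (reduce_word ws)"
  by (simp add: reduce_word_def reduced_word_foldr)

lemma reduce_word_reduced: "reduced_word ws \<Longrightarrow> reduce_word ws = ws"
proof (induction ws)
  case (Cons x ws)
  then have "reduce_word ws = ws" by (auto dest: reduced_word_ConsD)
  with Cons.prems show ?case by (cases ws) (auto simp: reduce_word_def)
qed (simp add: reduce_word_def)

lemma cancel_letter_cancel_letter:
  "reduced_word ys \<Longrightarrow> cancel_letter x (cancel_letter (inv_letter x) ys) = ys"
proof (cases ys)
  case (Cons y zs)
  assume "reduced_word ys"
  with Cons show ?thesis by (cases zs) auto
qed auto

text \<open>Each letter acts on reduced words by \<open>cancel_letter\<close>, and inverse letters
  act as mutually inverse maps, so deleting a cancelling pair from \<open>xs\<close> leaves the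
  action unchanged. Associativity of the product rests on this.\<close>

lemma foldr_cancel_letter_reduce_word:
  assumes "reduced_word ys"
  shows "foldr cancel_letter (reduce_word xs) ys = foldr cancel_letter xs ys"
proof (induction xs)
  case (Cons x xs)
  have "foldr cancel_letter (cancel_letter x zs) ys = cancel_letter x (foldr cancel_letter zs ys)"
    for zs
    by (cases zs) (auto simp: cancel_letter_cancel_letter reduced_word_foldr assms)
  with Cons show ?case by (simp add: reduce_word_def)
qed (simp add: reduce_word_def)

section \<open>The product of the free group and its cancellations\<close>

definition word_mult :: "letter list \<Rightarrow> letter list \<Rightarrow> letter list" (infixl "\<odot>" 70) where
  "xs \<odot> ys = reduce_word (xs @ ys)"

lemma mult_free_group [simp]: "x \<otimes>\<^bsub>free_group d\<^esub> y = x \<odot> y"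
  by (simp add: free_group_def word_mult_def)

lemma one_free_group [simp]: "\<one>\<^bsub>free_group d\<^esub> = []"
  by (simp add: free_group_def)

lemma reduced_word_mult [simp]: "reduced_word (xs \<odot> ys)"
  by (simp add: word_mult_def)

lemma word_mult_reduced: "reduced_word (xs @ ys) \<Longrightarrow> xs \<odot> ys = xs @ ys"
  by (simp add: word_mult_def reduce_word_reduced)

lemma word_mult_foldr: "reduced_word ys \<Longrightarrow> xs \<odot> ys = foldr cancel_letter xs ys"
  using reduce_word_reduced[of ys] by (simp add: word_mult_def reduce_word_def)

lemma word_mult_assoc: "(xs \<odot> ys) \<odot> zs = xs \<odot> (ys \<odot> zs)"
proof -
  have "(xs \<odot> ys) \<odot> zs = foldr cancel_letter (reduce_word (xs @ ys)) (reduce_word zs)"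
    by (simp add: word_mult_def reduce_word_def)
  also have "\<dots> = foldr cancel_letter xs (ys \<odot> zs)"
    by (subst foldr_cancel_letter_reduce_word[OF reduced_word_reduce_word])
       (simp add: word_mult_def reduce_word_def)
  finally show ?thesis by (simp add: word_mult_foldr)
qed

lemma word_mult_Nil_left: "reduced_word xs \<Longrightarrow> [] \<odot> xs = xs"
  and word_mult_Nil_right: "reduced_word xs \<Longrightarrow> xs \<odot> [] = xs"
  by (simp_all add: word_mult_reduced)

definition word_inv :: "letter list \<Rightarrow> letter list" where
  "word_inv xs = rev (map inv_letter xs)"

lemma word_inv_simps [simp]:
  "word_inv [] = []" "word_inv (x # xs) = word_inv xs @ [inv_letter x]"
  "word_inv (xs @ ys) = word_inv ys @ word_inv xs"
  "length (word_inv xs) = length xs" "word_inv (word_inv xs) = xs"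
  by (simp_all add: word_inv_def rev_map o_def)

lemma reduced_word_inv: "reduced_word xs \<Longrightarrow> reduced_word (word_inv xs)"
proof (induction xs)
  case (Cons x xs)
  then show ?case
    by (cases xs) (auto simp: reduced_word_append_iff inv_letter_eq_iff)
qed auto

lemma word_inv_mult_append:
  assumes "reduced_word (xs @ ys)"
  shows "word_inv xs \<odot> (xs @ ys) = ys"
  using assms
proof (induction xs)
  case (Cons x xs)
  then have r: "reduced_word (xs @ ys)" and R: "reduced_word (x # xs @ ys)"
    by (auto dest: reduced_word_ConsD)
  have "cancel_letter (inv_letter x) (x # xs @ ys) = xs @ ys" by simp
  then show ?case using Cons.IH[OF r] r R by (simp add: word_mult_foldr)
qed (simp add: word_mult_Nil_left)

lemma word_mult_left_cancel:
  assumes "reduced_word (xs @ ys)" "reduced_word zs" "xs \<odot> zs = xs @ ys"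
  shows "zs = ys"
proof -
  have "word_inv xs \<odot> (xs \<odot> zs) = (word_inv xs \<odot> xs) \<odot> zs" by (simp add: word_mult_assoc)
  also have "word_inv xs \<odot> xs = []"
    using word_inv_mult_append[of xs "[]"] assms(1) by (simp add: reduced_word_append_iff)
  finally show ?thesis
    using assms by (simp add: word_mult_Nil_left word_inv_mult_append)
qed

lemma word_mult_word_inv_append:
  assumes "reduced_word (u @ word_inv v)" "reduced_word (v @ w)" "reduced_word (u @ w)"
  shows "(u @ word_inv v) \<odot> (v @ w) = u @ w"
proof -
  have "(u @ word_inv v) \<odot> (v @ w) = (u \<odot> word_inv v) \<odot> (v @ w)"
    by (simp add: word_mult_reduced assms(1))
  also have "\<dots> = u \<odot> (word_inv v \<odot> (v @ w))"
    by (rule word_mult_assoc)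
  also have "\<dots> = u @ w"
    by (simp add: word_inv_mult_append assms(2)) (rule word_mult_reduced[OF assms(3)])
  finally show ?thesis .
qed

text \<open>Induction on the last letter of \<open>x\<close>: either it cancels against the head of
  \<open>y\<close> and both are stripped, or nothing cancels at all. The word \<open>v\<close> is
  the part of \<open>y\<close> that is lost.\<close>

lemma word_mult_cancellation:
  assumes "reduced_word x" "reduced_word y"
  obtains u v w where "x = u @ word_inv v" "y = v @ w" "reduced_word (u @ w)" "x \<odot> y = u @ w"
proof -
  have "\<exists>u v w. x = u @ word_inv v \<and> y = v @ w \<and> reduced_word (u @ w)"
    using assms
  proof (induction x arbitrary: y rule: rev_induct)
    case (snoc a x)
    show ?case
    proof (cases "y \<noteq> [] \<and> hd y = inv_letter a")
      case True
      then obtain y' where y: "y = inv_letter a # y'" by (cases y) auto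
      then obtain u v w where "x = u @ word_inv v" "y' = v @ w" "reduced_word (u @ w)"
        using snoc.IH[of y'] snoc.prems
        by (metis reduced_word_ConsD reduced_word_append_iff)
      then have "x @ [a] = u @ word_inv (inv_letter a # v) \<and> y = (inv_letter a # v) @ w
                   \<and> reduced_word (u @ w)"
        by (simp add: y)
      then show ?thesis by blast
    next
      case False
      then have "reduced_word ((x @ [a]) @ y)"
        using snoc.prems by (subst reduced_word_append_iff) auto
      then show ?thesis by (intro exI[of _ "x @ [a]"] exI[of _ "[]"] exI[of _ y]) auto
    qed
  qed (auto intro: exI[of _ "[]"])
  then obtain u v w where "x = u @ word_inv v" "y = v @ w" "reduced_word (u @ w)" by blast
  then show ?thesis using that assms word_mult_word_inv_append by blast
qed

lemma word_mult_letter_cases: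
  assumes "reduced_word x"
  obtains "x \<odot> [a] = x @ [a]" | "x = (x \<odot> [a]) @ [inv_letter a]"
proof -
  obtain u v w where *: "x = u @ word_inv v" "[a] = v @ w" "x \<odot> [a] = u @ w"
    using word_mult_cancellation[OF assms reduced_word_singleton[of a]] by metis
  then show ?thesis using that by (cases v) auto
qed

subsection \<open>Deterministic paths\<close>

text \<open>Semigroup elements are encoded by lists of times: this allows induction on the number of
  factors and reduces counting products to counting lists.\<close>

definition walk_prod :: "nat \<Rightarrow> (nat \<Rightarrow> letter list) \<Rightarrow> nat list \<Rightarrow> letter list" where
  "walk_prod d \<omega> ms = foldr (\<lambda>m acc. rw_pos (free_group d) \<omega> m \<odot> acc) ms []"

lemma walk_prod_simps [simp]:
  "walk_prod d \<omega> [] = []"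
  "walk_prod d \<omega> (m # ms) = rw_pos (free_group d) \<omega> m \<odot> walk_prod d \<omega> ms"
  by (simp_all add: walk_prod_def)

lemma reduced_walk_prod [simp]: "reduced_word (walk_prod d \<omega> ms)"
  by (cases ms) auto

lemma walk_prod_append: "walk_prod d \<omega> (ms @ ns) = walk_prod d \<omega> ms \<odot> walk_prod d \<omega> ns"
  by (induction ms) (auto simp: word_mult_assoc word_mult_Nil_left)

lemma rw_pos_0 [simp]: "rw_pos (free_group d) \<omega> 0 = []"
  and rw_pos_Suc:
    "rw_pos (free_group d) \<omega> (Suc n) = rw_pos (free_group d) \<omega> n \<odot> \<omega> n"
  by (simp_all add: rw_pos_def)

lemma reduced_rw_pos [simp]: "reduced_word (rw_pos (free_group d) \<omega> n)"
  by (cases n) (auto simp: rw_pos_Suc)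

lemma rw_pos_add:
  "rw_pos (free_group d) \<omega> (i + k) =
     rw_pos (free_group d) \<omega> i \<odot> rw_pos (free_group d) (\<lambda>j. \<omega> (i + j)) k"
  by (induction k) (auto simp: rw_pos_Suc word_mult_assoc word_mult_Nil_right)

lemma rw_tail_semigroup_walk_prod:
  assumes "x \<in> rw_tail_semigroup (free_group d) \<omega> n"
  shows "\<exists>ms. ms \<noteq> [] \<and> set ms \<subseteq> {n..} \<and> x = walk_prod d \<omega> ms"
  using assms unfolding rw_tail_semigroup_def
proof (induction rule: gen_semigroup.induct)
  case (gen a)
  then obtain m where "n \<le> m" "a = rw_pos (free_group d) \<omega> m" by auto
  then show ?case by (intro exI[of _ "[m]"]) (auto simp: word_mult_Nil_right)
next
  case (mult x y)
  then obtain ms ns where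
    "ms \<noteq> []" "set ms \<subseteq> {n..}" "x = walk_prod d \<omega> ms"
    "ns \<noteq> []" "set ns \<subseteq> {n..}" "y = walk_prod d \<omega> ns" by auto
  then show ?case
    by (intro exI[of _ "ms @ ns"]) (auto simp: walk_prod_append)
qed

section \<open>Nearest-neighbour paths in the tree of reduced words\<close>

locale letter_path =
  fixes d :: nat and \<omega> :: "nat \<Rightarrow> letter list"
  assumes letter_step: "\<exists>a. \<omega> i = [a]"
begin

abbreviation X :: "nat \<Rightarrow> letter list" where
  "X n \<equiv> rw_pos (free_group d) \<omega> n"

lemma X_Suc_cases:
  obtains a where "X (Suc n) = X n @ [a]" | a where "X n = X (Suc n) @ [a]"
proof -
  obtain a where "\<omega> n = [a]" using letter_step by blast
  then show ?thesis
    using word_mult_letter_cases[OF reduced_rw_pos[of d \<omega> n], of a] that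
    by (metis rw_pos_Suc)
qed

lemma length_X_le: "length (X n) \<le> n"
proof (induction n)
  case (Suc n)
  then show ?case by (cases n rule: X_Suc_cases) auto
qed simp

text \<open>A step only appends or deletes a last letter, so the first \<open>k\<close> letters
  cannot change while the length stays at least \<open>k\<close>.\<close>

lemma take_X_stable:
  assumes "\<And>i. J \<le> i \<Longrightarrow> k \<le> length (X i)" "J \<le> m"
  shows "take k (X m) = take k (X J)"
  using assms(2)
proof (induction m rule: dec_induct)
  case (step m)
  have "k \<le> length (X m)" "k \<le> length (X (Suc m))" using assms(1) step by auto
  then have "take k (X (Suc m)) = take k (X m)" by (cases m rule: X_Suc_cases) auto
  with step show ?case by simp
qed simp

text \<open>In the tree of reduced words, the words extending \<open>p\<close> can be entered only
  through \<open>p\<close>. Going back in time, as long as \<open>t\<close> is nonempty the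
  preceding position still extends \<open>p\<close>; at time \<open>J\<close> the length bound
  forces \<open>t = []\<close>.\<close>

lemma X_visits_prefix:
  assumes "X m = p @ t" "length (X J) \<le> length p" "J \<le> m"
  shows "\<exists>i\<in>{J..m}. X i = p"
  using assms(3,1)
proof (induction m arbitrary: t rule: dec_induct)
  case base
  with assms(2) show ?case by (intro bexI[of _ J]) auto
next
  case (step m)
  have "(\<exists>i\<in>{J..m}. X i = p) \<or> t = []"
  proof (cases m rule: X_Suc_cases)
    case (1 a)
    with step.prems show ?thesis using step.IH[of "butlast t"]
      by (cases t rule: rev_cases) auto
  next
    case (2 a)
    with step.prems show ?thesis using step.IH[of "t @ [a]"] by auto
  qed
  with step show ?case by (auto intro: bexI[of _ "Suc m"])
qed

lemma segment_eq_suffix: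
  assumes "X m = p @ t" "length (X J) \<le> length p" "J \<le> m"
  shows "\<exists>i\<in>{J..m}. rw_pos (free_group d) (\<lambda>j. \<omega> (i + j)) (m - i) = t"
proof -
  obtain i where i: "i \<in> {J..m}" "X i = p" using X_visits_prefix[OF assms] by blast
  have "p \<odot> rw_pos (free_group d) (\<lambda>j. \<omega> (i + j)) (m - i) = p @ t"
    using rw_pos_add[of d \<omega> i "m - i"] i assms(1) by simp
  moreover have "reduced_word (p @ t)" using assms(1) reduced_rw_pos[of d \<omega> m] by simp
  ultimately show ?thesis using i word_mult_left_cancel reduced_rw_pos by blast
qed

end

text \<open>The paths outside all bad events. In \<open>no_coincidence\<close> every time in
  \<open>ms\<close> is at most \<open>8 * (m div 64)\<close>, hence at most \<open>i\<close>, so the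
  product is determined before the segment starts; this is what makes the two independent.\<close>

locale good_path = letter_path +
  fixes n0 :: nat
  assumes escape: "n0 \<le> i \<Longrightarrow> i \<le> 4 * length (X i)"
    and no_coincidence:
      "\<lbrakk>64 * n0 \<le> m; i \<in> {8 * (m div 64)..m}; set ms \<subseteq> {n0..8 * (m div 64)};
        sum_list ms \<le> 16 * (m div 64); m div 64 \<le> length (walk_prod d \<omega> ms)\<rbrakk> \<Longrightarrow>
       rw_pos (free_group d) (\<lambda>j. \<omega> (i + j)) (m - i) \<noteq>
         word_inv (take (m div 64) (walk_prod d \<omega> ms))"
begin

text \<open>The prefix \<open>v\<close> of the product that cancels against the end of \<open>X m\<close> is much shorter than
  \<open>X m\<close>, which has length at least \<open>m / 4\<close>.\<close>

definition small_cancellation :: "nat list \<Rightarrow> bool" where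
  "small_cancellation ms \<longleftrightarrow>
     (\<forall>m u v w. 64 * n0 \<le> m \<longrightarrow> X m = u @ word_inv v \<longrightarrow> walk_prod d \<omega> ms = v @ w
        \<longrightarrow> length v < m div 64)"

text \<open>A factor \<open>X m\<close> with \<open>m > 8 * h\<close> may be replaced by \<open>X (8 * h)\<close>, because the prefix of length
  \<open>h\<close> has stabilised by then; everything after such a factor is irrelevant. Each earlier factor
  \<open>X m\<close> lengthens the known prefix by at least \<open>m / 8\<close>, whence the bound on the sum of the
  indices.\<close>

lemma prefix_of_short_product:
  assumes "n0 \<le> h" "set ms \<subseteq> {64 * n0..}" "k \<le> h" "k \<le> length (walk_prod d \<omega> ms)"
    and "\<And>ns. length ns < length ms \<Longrightarrow> set ns \<subseteq> {64 * n0..} \<Longrightarrow> small_cancellation ns"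
  shows "\<exists>ns. set ns \<subseteq> {n0..8 * h} \<and> sum_list ns \<le> 8 * h + 8 * k \<and>
    k \<le> length (walk_prod d \<omega> ns) \<and> take k (walk_prod d \<omega> ns) = take k (walk_prod d \<omega> ms)"
  using assms(2-)
proof (induction ms arbitrary: k)
  case Nil
  then show ?case by (intro exI[of _ "[]"]) auto
next
  case (Cons m ms)
  let ?P = "walk_prod d \<omega>"
  have m: "64 * n0 \<le> m" "n0 \<le> m" using Cons.prems by auto
  obtain u v w where uvw: "X m = u @ word_inv v" "?P ms = v @ w" "reduced_word (u @ w)"
      "X m \<odot> ?P ms = u @ w"
    using word_mult_cancellation[OF reduced_rw_pos reduced_walk_prod] by blast
  have v: "length v < m div 64"
    using Cons.prems(4)[of ms] Cons.prems(1) uvw m unfolding small_cancellation_def by auto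
  have v64: "64 * length v \<le> m" using v by linarith
  have len: "length (X m) = length u + length v" "m \<le> 4 * length (X m)"
    using uvw(1) escape[of m] m by simp_all
  have P: "?P (m # ms) = u @ w" using uvw by simp
  show ?case
  proof (cases "k \<le> length u")
    case ku: True
    have tk: "take k (?P (m # ms)) = take k (X m)" using ku P uvw by simp
    show ?thesis
    proof (cases "m \<le> 8 * h")
      case True
      then show ?thesis using tk m len ku
        by (intro exI[of _ "[m]"]) (auto simp: word_mult_Nil_right)
    next
      case False
      have *: "k \<le> length (X i)" if "8 * h \<le> i" for i
        using escape[of i] that assms(1) \<open>k \<le> h\<close> by linarith
      have "take k (X m) = take k (X (8 * h))"
        using take_X_stable[of "8 * h" k m] * False by simp
      then show ?thesis using tk *[of "8 * h"] assms(1)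
        by (intro exI[of _ "[8 * h]"]) (auto simp: word_mult_Nil_right)
    qed
  next
    case False
    \<comment> \<open>The prefix reaches \<open>l\<close> letters into \<open>w\<close>, so the tail
      product has to be known up to length \<open>length v + l\<close>, its cancelled part
      \<open>v\<close> included.\<close>
    define l where "l = k - length u"
    have l: "0 < l" "k = length u + l" "l \<le> length w"
      using False Cons.prems(3) P by (auto simp: l_def)
    have mle: "m \<le> 8 * h"
      using l len v64 \<open>k \<le> h\<close> by linarith
    \<comment> \<open>This pays for the new entry \<open>m\<close> in the sum of indices and also
      keeps \<open>length v + l\<close> below \<open>h\<close> for the induction hypothesis. It
      holds since \<open>length v\<close> is at most \<open>m / 64\<close> while \<open>u\<close>
      and \<open>v\<close> together have length at least \<open>m / 4\<close>.\<close>
    have k1: "8 * (length v + l) + m \<le> 8 * k"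
    proof -
      have "m \<le> 4 * (length u + length v)" using len by simp
      then have "16 * length v + m \<le> 8 * (length u + length v)" using v64 by linarith
      then show ?thesis using l(2) by simp
    qed
    obtain ns where ns: "set ns \<subseteq> {n0..8 * h}" "sum_list ns \<le> 8 * h + 8 * (length v + l)"
      "length v + l \<le> length (?P ns)" "take (length v + l) (?P ns) = take (length v + l) (?P ms)"
      using Cons.IH[of "length v + l"] Cons.prems uvw l k1 by force
    define z where "z = drop (length v + l) (?P ns)"
    have Pns: "?P ns = v @ (take l w @ z)"
      using ns(4) append_take_drop_id[of "length v + l" "?P ns"] uvw(2) by (simp add: z_def)
    have "reduced_word (v @ take l w @ z)" "reduced_word (u @ take l w @ drop l w)"
      using uvw(3) by (simp_all flip: Pns)
    \<comment> \<open>Because \<open>take l w\<close> is nonempty, its junctions with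
      \<open>u\<close> and with \<open>z\<close> each occur in one of the two reduced words above.
      So exchanging \<open>drop l w\<close> for \<open>z\<close> creates no new
      cancellation.\<close>
    moreover have "take l w \<noteq> []" using l by auto
    ultimately have "reduced_word (u @ take l w @ z)"
      by (auto simp: reduced_word_append_iff simp del: append_take_drop_id)
    moreover have "reduced_word (u @ word_inv v)" "reduced_word (v @ (take l w @ z))"
      by (simp_all flip: uvw(1) Pns)
    ultimately have "?P (m # ns) = u @ take l w @ z"
      using word_mult_word_inv_append[of u v "take l w @ z"] uvw(1) Pns by simp
    then show ?thesis
      using ns mle m k1 l P by (intro exI[of _ "m # ns"]) auto
  qed
qed

text \<open>Strong induction on the number of factors, since \<open>prefix_of_short_product\<close>
  uses the claim only for shorter lists. Taking \<open>k = h\<close> there gives the bound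
  \<open>16 * h\<close> on the sum of indices; a long \<open>v\<close> then produces an excluded
  coincidence.\<close>

lemma small_cancellation_walk_prod:
  assumes "set ms \<subseteq> {64 * n0..}"
  shows "small_cancellation ms"
  using assms
proof (induction ms rule: length_induct)
  case (1 ms)
  show ?case unfolding small_cancellation_def
  proof (intro allI impI, rule ccontr)
    fix m u v w
    assume m: "64 * n0 \<le> m" and X: "X m = u @ word_inv v" and P: "walk_prod d \<omega> ms = v @ w"
      and "\<not> length v < m div 64"
    define h where "h = m div 64"
    have h: "h \<le> length v" "n0 \<le> h" "64 * h \<le> m" using \<open>\<not> length v < m div 64\<close> m by (auto simp: h_def)
    obtain ns where ns: "set ns \<subseteq> {n0..8 * h}" "sum_list ns \<le> 16 * h"
      "h \<le> length (walk_prod d \<omega> ns)" "take h (walk_prod d \<omega> ns) = take h v"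
      using prefix_of_short_product[of h ms h] 1 h P by auto
    have "X m = (u @ word_inv (drop h v)) @ word_inv (take h v)"
      using X by (metis append.assoc append_take_drop_id word_inv_simps(3))
    \<comment> \<open>At time \<open>8 * h\<close> the length is at most \<open>8 * h\<close>,
      whereas \<open>X m\<close> without its last \<open>h\<close> letters still has length at least
      \<open>16 * h - h\<close>.\<close>
    moreover have "length (X (8 * h)) \<le> length (u @ word_inv (drop h v))"
    proof -
      have "length (X m) = length (u @ word_inv (drop h v)) + h"
        using calculation h by simp
      then show ?thesis using length_X_le[of "8 * h"] escape[of m] m h by linarith
    qed
    ultimately obtain i where "i \<in> {8 * h..m}"
      "rw_pos (free_group d) (\<lambda>j. \<omega> (i + j)) (m - i) = word_inv (take h v)"
      using segment_eq_suffix[of m "u @ word_inv (drop h v)" "word_inv (take h v)" "8 * h"] h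
      by auto
    then show False using no_coincidence[of m i ns] m ns by (simp add: h_def)
  qed
qed

text \<open>In a product equal to the identity the first factor \<open>X m\<close> would be
  cancelled entirely, but it has length at least \<open>m / 4\<close> and loses fewer than
  \<open>m div 64\<close> letters.\<close>

lemma Nil_notin_tail_semigroup: "[] \<notin> rw_tail_semigroup (free_group d) \<omega> (64 * n0)"
proof
  assume "[] \<in> rw_tail_semigroup (free_group d) \<omega> (64 * n0)"
  then obtain ms' where "ms' \<noteq> []" "set ms' \<subseteq> {64 * n0..}" "walk_prod d \<omega> ms' = []"
    using rw_tail_semigroup_walk_prod by metis
  then obtain m ms where ms: "set ms \<subseteq> {64 * n0..}" "64 * n0 \<le> m" "X m \<odot> walk_prod d \<omega> ms = []"
    by (cases ms') auto
  obtain u v w where uvw: "X m = u @ word_inv v" "walk_prod d \<omega> ms = v @ w"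
      "X m \<odot> walk_prod d \<omega> ms = u @ w"
    using word_mult_cancellation[OF reduced_rw_pos reduced_walk_prod] by blast
  then have "length v < m div 64"
    using small_cancellation_walk_prod[OF ms(1)] ms(2) unfolding small_cancellation_def by blast
  moreover have "length (X m) = length v" using uvw ms by simp
  ultimately show False using escape[of m] ms by linarith
qed

end

subsection \<open>Escape and coincidence probabilities\<close>

lemma space_rw_space [simp]: "space (rw_space \<mu>) = UNIV"
  by (simp add: rw_space_def space_PiM)

lemma prob_space_rw_space: "prob_space (rw_space \<mu>)"
  unfolding rw_space_def by (intro prob_space_PiM prob_space_measure_pmf)

lemma measurable_coordinate: "(\<lambda>\<omega>. \<omega> i) \<in> measurable (rw_space \<mu>) (count_space UNIV)"
proof -
  have "(\<lambda>\<omega>. \<omega> i) \<in> measurable (rw_space \<mu>) (measure_pmf \<mu>)"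
    unfolding rw_space_def by (rule measurable_component_singleton) simp
  then show ?thesis by (simp cong: measurable_cong_sets)
qed

lemma measurable_countable_op:
  fixes f :: "'m \<Rightarrow> 'a::countable"
  assumes "f \<in> measurable M (count_space UNIV)" "g \<in> measurable M (count_space UNIV)"
  shows "(\<lambda>x. h (f x) (g x)) \<in> measurable M (count_space UNIV)"
  by (rule measurable_compose_countable[where f = "\<lambda>a x. h a (g x)" and g = f])
     (auto intro: assms measurable_compose[OF assms(2)])

lemma measurable_segment [measurable]:
  "(\<lambda>\<omega>. rw_pos (free_group d) (\<lambda>j. \<omega> (i + j)) k) \<in> measurable (rw_space \<mu>) (count_space UNIV)"
  by (induction k) (auto simp: rw_pos_Suc intro: measurable_countable_op measurable_coordinate)

lemma measurable_rw_pos [measurable]: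
  "(\<lambda>\<omega>. rw_pos (free_group d) \<omega> k) \<in> measurable (rw_space \<mu>) (count_space UNIV)"
  using measurable_segment[of d 0 k \<mu>] by simp

lemma measurable_walk_prod [measurable]:
  "(\<lambda>\<omega>. walk_prod d \<omega> ms) \<in> measurable (rw_space \<mu>) (count_space UNIV)"
  by (induction ms) (auto intro: measurable_countable_op measurable_rw_pos)

lemma nn_integral_rw_space_iter:
  assumes [measurable]: "f \<in> borel_measurable (rw_space \<mu>)"
  shows "(\<integral>\<^sup>+\<omega>. f \<omega> \<partial>rw_space \<mu>) =
    (\<integral>\<^sup>+s. \<integral>\<^sup>+\<omega>. f (case_nat s \<omega>) \<partial>rw_space \<mu> \<partial>measure_pmf \<mu>)"
proof -
  interpret sequence_space "measure_pmf \<mu>" by unfold_locales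
  have S: "rw_space \<mu> = S" by (simp add: rw_space_def)
  have f: "f \<in> borel_measurable S" using assms by (simp add: S)
  have [measurable]: "(\<lambda>(s, \<omega>). case_nat s \<omega>) \<in> measurable (measure_pmf \<mu> \<Otimes>\<^sub>M S) S" by measurable
  have "(\<integral>\<^sup>+\<omega>. f \<omega> \<partial>S) = (\<integral>\<^sup>+\<omega>. f \<omega> \<partial>distr (measure_pmf \<mu> \<Otimes>\<^sub>M S) S (\<lambda>(s, \<omega>). case_nat s \<omega>))"
    by (simp only: PiM_iter)
  also have "\<dots> = (\<integral>\<^sup>+x. f (case x of (s, \<omega>) \<Rightarrow> case_nat s \<omega>) \<partial>(measure_pmf \<mu> \<Otimes>\<^sub>M S))"
    using f by (intro nn_integral_distr) auto
  also have "\<dots> = (\<integral>\<^sup>+s. \<integral>\<^sup>+\<omega>. f (case_nat s \<omega>) \<partial>S \<partial>measure_pmf \<mu>)"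
    using f by (subst P.nn_integral_fst[symmetric]) auto
  finally show ?thesis by (simp add: S)
qed

lemma nn_integral_rw_space_comb:
  assumes [measurable]: "f \<in> borel_measurable (rw_space \<mu>)"
  shows "(\<integral>\<^sup>+\<omega>. f \<omega> \<partial>rw_space \<mu>) =
    (\<integral>\<^sup>+\<omega>. \<integral>\<^sup>+\<omega>'. f (comb_seq i \<omega> \<omega>') \<partial>rw_space \<mu> \<partial>rw_space \<mu>)"
proof -
  interpret sequence_space "measure_pmf \<mu>" by unfold_locales
  have S: "rw_space \<mu> = S" by (simp add: rw_space_def)
  have f: "f \<in> borel_measurable S" using assms by (simp add: S)
  have "(\<integral>\<^sup>+\<omega>. f \<omega> \<partial>S) = (\<integral>\<^sup>+\<omega>. f \<omega> \<partial>distr (S \<Otimes>\<^sub>M S) S (\<lambda>(\<omega>, \<omega>'). comb_seq i \<omega> \<omega>'))"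
    by (simp only: PiM_comb_seq)
  also have "\<dots> = (\<integral>\<^sup>+x. f (case x of (\<omega>, \<omega>') \<Rightarrow> comb_seq i \<omega> \<omega>') \<partial>(S \<Otimes>\<^sub>M S))"
    using f by (intro nn_integral_distr measurable_comb_seq) simp
  also have "\<dots> = (\<integral>\<^sup>+\<omega>. \<integral>\<^sup>+\<omega>'. f (comb_seq i \<omega> \<omega>') \<partial>S \<partial>S)"
    using f measurable_compose[OF measurable_comb_seq f] by (subst P.nn_integral_fst[symmetric]) auto
  finally show ?thesis by (simp add: S)
qed

section \<open>Exponential decay along the walk\<close>

lemma mu_free_eq: "mu_free d = pmf_of_set ((\<lambda>p. [p]) ` ({..<d} \<times> UNIV))"
  unfolding mu_free_def by (intro arg_cong[of _ _ pmf_of_set]) auto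

lemma set_pmf_mu_free: "0 < d \<Longrightarrow> set_pmf (mu_free d) = (\<lambda>p. [p]) ` ({..<d} \<times> UNIV)"
  unfolding mu_free_eq by (subst set_pmf_of_set) auto

text \<open>At most one of the \<open>2 * d\<close> letters shortens \<open>g\<close>, multiplying
  the function by 3; all others multiply it by 1/3. The mean factor is at most
  \<open>1/3 + (8/3) / (2 * d)\<close>, which equals 3/5 for \<open>d = 5\<close>; this is where
  \<open>d > 4\<close> enters.\<close>

lemma mu_free_step_decay:
  assumes "d > 4" and g: "reduced_word g"
  shows "(\<integral>\<^sup>+z. ennreal ((1/3) ^ length (g \<odot> z)) \<partial>measure_pmf (mu_free d))
    \<le> ennreal (3/5 * (1/3) ^ length g)"
proof -
  let ?A = "(\<lambda>p. [p]) ` ({..<d} \<times> (UNIV :: bool set))" and ?c = "(1/3::real) ^ length g"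
  have A: "finite ?A" "card ?A = 2 * d" "?A \<noteq> {}"
    using assms by (auto simp: card_image inj_on_def card_cartesian_product)
  \<comment> \<open>The value 8/3 is the difference between the factors 3 and 1/3. For empty
    \<open>g\<close> the word \<open>last g\<close> is arbitrary, but then every letter lengthens
    \<open>g\<close> and the extra term is nonnegative.\<close>
  have le: "(1/3) ^ length (g \<odot> z) \<le> ?c / 3 + (if z = [inv_letter (last g)] then 8/3 * ?c else 0)"
    if z: "z \<in> ?A" for z
  proof -
    obtain a where a: "z = [a]" using z by auto
    show ?thesis
    proof (rule word_mult_letter_cases[OF g, of a])
      assume "g = g \<odot> [a] @ [inv_letter a]"
      then have "last g = inv_letter a" "length g = Suc (length (g \<odot> [a]))"
        by (metis last_snoc, metis length_append_singleton)
      then show ?thesis by (simp add: a)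
    qed (simp add: a)
  qed
  have "(\<Sum>z\<in>?A. (1/3) ^ length (g \<odot> z))
      \<le> (\<Sum>z\<in>?A. ?c / 3 + (if z = [inv_letter (last g)] then 8/3 * ?c else 0))"
    by (intro sum_mono le)
  also have "\<dots> \<le> real (2 * d) * (?c / 3) + 8/3 * ?c"
    using A by (simp add: sum.distrib)
  also have "\<dots> \<le> 3/5 * ?c * real (2 * d)"
  proof -
    have "?c * (2 * real d / 3 + 8/3) \<le> ?c * (6/5 * real d)"
      using assms by (intro mult_left_mono) auto
    then show ?thesis by (simp add: algebra_simps)
  qed
  finally have "(\<Sum>z\<in>?A. (1/3) ^ length (g \<odot> z)) / real (2 * d) \<le> 3/5 * ?c"
    using assms by (simp add: divide_le_eq)
  then have "measure_pmf.expectation (mu_free d) (\<lambda>z. (1/3) ^ length (g \<odot> z)) \<le> 3/5 * ?c"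
    using A unfolding mu_free_eq by (subst integral_pmf_of_set) auto
  moreover have "integrable (mu_free d) (\<lambda>z. (1/3::real) ^ length (g \<odot> z))"
    using A assms by (intro integrable_measure_pmf_finite) (simp add: set_pmf_mu_free)
  ultimately show ?thesis
    by (subst nn_integral_eq_integral) (auto intro: ennreal_leI)
qed

text \<open>Induction on \<open>k\<close> by conditioning on the first step, which is absorbed into
  the arbitrary starting word \<open>g\<close>.\<close>

lemma rw_decay:
  assumes "d > 4" and "reduced_word g"
  shows "(\<integral>\<^sup>+\<omega>. ennreal ((1/3) ^ length (g \<odot> rw_pos (free_group d) \<omega> k)) \<partial>rw_space (mu_free d))
    \<le> ennreal ((3/5) ^ k * (1/3) ^ length g)"
  using assms(2)
proof (induction k arbitrary: g)
  case 0
  interpret prob_space "rw_space (mu_free d)" by (rule prob_space_rw_space)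
  show ?case using 0 emeasure_space_1 by (simp add: word_mult_Nil_right)
next
  case (Suc k)
  have step: "g \<odot> rw_pos (free_group d) (case_nat s \<omega>) (Suc k) = (g \<odot> s) \<odot> rw_pos (free_group d) \<omega> k"
    for s \<omega>
  proof -
    have "rw_pos (free_group d) (case_nat s \<omega>) (Suc k) = ([] \<odot> s) \<odot> rw_pos (free_group d) \<omega> k"
      using rw_pos_add[of d "case_nat s \<omega>" 1 k] by (simp add: rw_pos_Suc)
    then show ?thesis using Suc.prems by (simp add: word_mult_Nil_right flip: word_mult_assoc)
  qed
  have "(\<integral>\<^sup>+\<omega>. ennreal ((1/3) ^ length (g \<odot> rw_pos (free_group d) \<omega> (Suc k))) \<partial>rw_space (mu_free d))
    = (\<integral>\<^sup>+s. \<integral>\<^sup>+\<omega>. ennreal ((1/3) ^ length ((g \<odot> s) \<odot> rw_pos (free_group d) \<omega> k))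
         \<partial>rw_space (mu_free d) \<partial>mu_free d)"
    by (subst nn_integral_rw_space_iter)
       (auto simp: step intro!: measurable_compose[OF measurable_rw_pos])
  also have "\<dots> \<le> (\<integral>\<^sup>+s. ennreal ((3/5) ^ k) * ennreal ((1/3) ^ length (g \<odot> s)) \<partial>mu_free d)"
    using Suc.IH by (intro nn_integral_mono) (simp flip: ennreal_mult)
  also have "\<dots> = ennreal ((3/5) ^ k) * (\<integral>\<^sup>+s. ennreal ((1/3) ^ length (g \<odot> s)) \<partial>mu_free d)"
    by (rule nn_integral_cmult) simp
  also have "\<dots> \<le> ennreal ((3/5) ^ k) * ennreal (3/5 * (1/3) ^ length g)"
    using mu_free_step_decay[OF assms(1) Suc.prems] by (intro mult_left_mono) auto
  also have "\<dots> = ennreal ((3/5) ^ Suc k * (1/3) ^ length g)"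
    by (simp add: mult_ac flip: ennreal_mult)
  finally show ?case .
qed

text \<open>Start the walk at \<open>word_inv r\<close>: on the event it ends at the empty word,
  where the decaying function equals 1. A word that is not reduced is never attained.\<close>

lemma emeasure_rw_pos_eq_le:
  assumes "d > 4"
  shows "emeasure (rw_space (mu_free d)) {\<omega>. rw_pos (free_group d) \<omega> k = r}
    \<le> ennreal ((3/5) ^ k * (1/3) ^ length r)"
proof (cases "reduced_word r")
  case True
  have [measurable]: "{\<omega>. rw_pos (free_group d) \<omega> k = r} \<in> sets (rw_space (mu_free d))"
    using measurable_sets[OF measurable_rw_pos[of d k "mu_free d"], of "{r}"] by (simp add: vimage_def)
  have "emeasure (rw_space (mu_free d)) {\<omega>. rw_pos (free_group d) \<omega> k = r}
      = (\<integral>\<^sup>+\<omega>. indicator {\<omega>. rw_pos (free_group d) \<omega> k = r} \<omega> \<partial>rw_space (mu_free d))"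
    by simp
  also have "\<dots> \<le> (\<integral>\<^sup>+\<omega>. ennreal ((1/3) ^ length (word_inv r \<odot> rw_pos (free_group d) \<omega> k))
      \<partial>rw_space (mu_free d))"
    using word_inv_mult_append[of r "[]"] True
    by (intro nn_integral_mono) (auto simp: indicator_def)
  also have "\<dots> \<le> ennreal ((3/5) ^ k * (1/3) ^ length r)"
    using rw_decay[OF assms reduced_word_inv[OF True], of k] by simp
  finally show ?thesis .
next
  case False
  then have "{\<omega>. rw_pos (free_group d) \<omega> k = r} = {}" using reduced_rw_pos by auto
  then show ?thesis by simp
qed

section \<open>Probability of slow escape\<close>

definition slow_escape :: "nat \<Rightarrow> nat \<Rightarrow> (nat \<Rightarrow> letter list) set" where
  "slow_escape d m = {\<omega>. 4 * length (rw_pos (free_group d) \<omega> m) < m}"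

lemma sets_slow_escape: "slow_escape d m \<in> sets (rw_space \<mu>)"
proof -
  have "{\<omega> \<in> space (rw_space \<mu>). 4 * length (rw_pos (free_group d) \<omega> m) < m} \<in> sets (rw_space \<mu>)"
    by measurable
  then show ?thesis by (simp add: slow_escape_def)
qed

lemma measure_slow_escape_le:
  assumes "d > 4"
  shows "measure (rw_space (mu_free d)) (slow_escape d m) \<le> (4/5) ^ m"
proof -
  interpret prob_space "rw_space (mu_free d)" by (rule prob_space_rw_space)
  note [measurable] = sets_slow_escape
  let ?X = "\<lambda>\<omega>. rw_pos (free_group d) \<omega> m"
  \<comment> \<open>Here \<open>(4/3) ^ 4 = 256/81\<close> exceeds 3; against the decay
    \<open>(3/5) ^ m\<close> this leaves \<open>(4/5) ^ m\<close> in Markov's inequality.\<close>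
  have three: "(3::real) ^ (m div 4) \<le> (4/3) ^ m"
  proof -
    have "(3::real) ^ (m div 4) \<le> ((4/3) ^ 4) ^ (m div 4)" by (intro power_mono) (auto simp: power_divide)
    also have "\<dots> \<le> (4/3) ^ m" unfolding power_mult[symmetric] by (intro power_increasing) auto
    finally show ?thesis .
  qed
  have ind: "indicator (slow_escape d m) \<omega> \<le> ennreal (3 ^ (m div 4)) * ennreal ((1/3) ^ length ([] \<odot> ?X \<omega>))"
    for \<omega>
  proof (cases "\<omega> \<in> slow_escape d m")
    case True
    then have "length (?X \<omega>) \<le> m div 4" by (auto simp: slow_escape_def)
    then have "(3::real) ^ length (?X \<omega>) \<le> 3 ^ (m div 4)" by (intro power_increasing) auto
    then have "1 \<le> 3 ^ (m div 4) * (1/3::real) ^ length (?X \<omega>)" by (simp add: power_divide)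
    then have "ennreal 1 \<le> ennreal (3 ^ (m div 4) * (1/3) ^ length (?X \<omega>))" by (rule ennreal_leI)
    then show ?thesis using True by (simp add: word_mult_Nil_left flip: ennreal_mult)
  qed simp
  have "emeasure (rw_space (mu_free d)) (slow_escape d m)
      = (\<integral>\<^sup>+\<omega>. indicator (slow_escape d m) \<omega> \<partial>rw_space (mu_free d))"
    by simp
  also have "\<dots> \<le> (\<integral>\<^sup>+\<omega>. ennreal (3 ^ (m div 4)) * ennreal ((1/3) ^ length ([] \<odot> ?X \<omega>)) \<partial>rw_space (mu_free d))"
    by (intro nn_integral_mono ind)
  also have "\<dots> = ennreal (3 ^ (m div 4)) * (\<integral>\<^sup>+\<omega>. ennreal ((1/3) ^ length ([] \<odot> ?X \<omega>)) \<partial>rw_space (mu_free d))"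
    by (intro nn_integral_cmult measurable_compose[OF measurable_rw_pos]) simp
  also have "\<dots> \<le> ennreal (3 ^ (m div 4)) * ennreal ((3/5) ^ m)"
    using rw_decay[OF assms reduced_word_Nil, of m] by (intro mult_left_mono) auto
  also have "\<dots> \<le> ennreal ((4/3) ^ m * (3/5) ^ m)"
    using three by (simp flip: ennreal_mult add: mult_right_mono)
  also have "(4/3) ^ m * (3/5) ^ m = (4/5::real) ^ m" by (simp flip: power_mult_distrib)
  finally show ?thesis by (simp add: emeasure_eq_measure)
qed

section \<open>Probability of a single coincidence\<close>

definition coincidence :: "nat \<Rightarrow> nat \<Rightarrow> nat \<Rightarrow> nat \<Rightarrow> nat list \<Rightarrow> (nat \<Rightarrow> letter list) set" where
  "coincidence d h i k ms = {\<omega>. h \<le> length (walk_prod d \<omega> ms) \<and>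
     rw_pos (free_group d) (\<lambda>j. \<omega> (i + j)) k = word_inv (take h (walk_prod d \<omega> ms))}"

lemma sets_coincidence: "coincidence d h i k ms \<in> sets (rw_space \<mu>)"
proof -
  have "(\<lambda>\<omega>. h \<le> length (walk_prod d \<omega> ms) \<and>
      rw_pos (free_group d) (\<lambda>j. \<omega> (i + j)) k = word_inv (take h (walk_prod d \<omega> ms)))
      \<in> measurable (rw_space \<mu>) (count_space UNIV)"
    by (intro measurable_countable_op[where h = "\<lambda>p y. h \<le> length p \<and> y = word_inv (take h p)"]
        measurable_walk_prod measurable_segment)
  from measurable_sets[OF this, of "{True}"] show ?thesis
    by (simp add: coincidence_def vimage_def)
qed

lemma rw_pos_cong:
  assumes "\<And>j. j < n \<Longrightarrow> \<omega> j = \<omega>' j"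
  shows "rw_pos (free_group d) \<omega> n = rw_pos (free_group d) \<omega>' n"
  using assms by (induction n) (auto simp: rw_pos_Suc)

lemma walk_prod_comb_seq:
  "set ms \<subseteq> {..i} \<Longrightarrow> walk_prod d (comb_seq i \<omega> \<omega>') ms = walk_prod d \<omega> ms"
proof (induction ms)
  case (Cons m ms)
  have "rw_pos (free_group d) (comb_seq i \<omega> \<omega>') m = rw_pos (free_group d) \<omega> m"
    using Cons.prems by (intro rw_pos_cong) (auto simp: comb_seq_less)
  with Cons show ?case by simp
qed simp

text \<open>Given the first \<open>i\<close> steps, the product is fixed, and the independent later
  steps must spell one given word of length \<open>h\<close>.\<close>

lemma measure_coincidence_le:
  assumes "d > 4" "set ms \<subseteq> {..i}"
  shows "measure (rw_space (mu_free d)) (coincidence d h i k ms) \<le> (3/5) ^ k * (1/3) ^ h"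
proof -
  interpret prob_space "rw_space (mu_free d)" by (rule prob_space_rw_space)
  let ?M = "rw_space (mu_free d)" and ?b = "(3/5) ^ k * (1/3::real) ^ h"
  note [measurable] = sets_coincidence
  have inner: "(\<integral>\<^sup>+\<omega>'. indicator (coincidence d h i k ms) (comb_seq i \<omega> \<omega>') \<partial>?M) \<le> ennreal ?b" for \<omega>
  proof (cases "h \<le> length (walk_prod d \<omega> ms)")
    case True
    define r where "r = word_inv (take h (walk_prod d \<omega> ms))"
    have [measurable]: "{\<omega>'. rw_pos (free_group d) \<omega>' k = r} \<in> sets ?M"
      using measurable_sets[OF measurable_rw_pos[of d k "mu_free d"], of "{r}"] by (simp add: vimage_def)
    have "(\<integral>\<^sup>+\<omega>'. indicator (coincidence d h i k ms) (comb_seq i \<omega> \<omega>') \<partial>?M)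
        \<le> (\<integral>\<^sup>+\<omega>'. indicator {\<omega>'. rw_pos (free_group d) \<omega>' k = r} \<omega>' \<partial>?M)"
      by (intro nn_integral_mono)
         (auto simp: indicator_def coincidence_def walk_prod_comb_seq[OF assms(2)] r_def
            comb_seq_add[of i \<omega>, unfolded add.commute[of _ i]])
    also have "\<dots> \<le> ennreal ?b"
    proof -
      have "length r = h" using True by (simp add: r_def)
      then show ?thesis using emeasure_rw_pos_eq_le[OF assms(1), of k r] by simp
    qed
    finally show ?thesis .
  next
    case False
    then show ?thesis by (simp add: coincidence_def walk_prod_comb_seq[OF assms(2)] indicator_def)
  qed
  have "emeasure ?M (coincidence d h i k ms) = (\<integral>\<^sup>+\<omega>. indicator (coincidence d h i k ms) \<omega> \<partial>?M)"
    by simp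
  also have "\<dots> = (\<integral>\<^sup>+\<omega>. \<integral>\<^sup>+\<omega>'. indicator (coincidence d h i k ms) (comb_seq i \<omega> \<omega>') \<partial>?M \<partial>?M)"
    by (rule nn_integral_rw_space_comb) simp
  also have "\<dots> \<le> (\<integral>\<^sup>+\<omega>. ennreal ?b \<partial>?M)" by (intro nn_integral_mono inner)
  also have "\<dots> = ennreal ?b" using emeasure_space_1 by simp
  finally show ?thesis by (simp add: emeasure_eq_measure)
qed

section \<open>Counting lists of times with bounded sum\<close>

definition bounded_lists :: "nat \<Rightarrow> nat \<Rightarrow> nat list set" where
  "bounded_lists n0 M = {ms. set ms \<subseteq> {n0..} \<and> sum_list ms \<le> M}"

lemma bounded_lists_subset:
  "bounded_lists n0 M \<subseteq> insert [] (\<Union>x\<in>{n0..M}. (#) x ` bounded_lists n0 (M - x))"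
proof
  fix ms assume "ms \<in> bounded_lists n0 M"
  then show "ms \<in> insert [] (\<Union>x\<in>{n0..M}. (#) x ` bounded_lists n0 (M - x))"
    by (cases ms) (auto simp: bounded_lists_def image_iff intro!: bexI[of _ "hd ms"])
qed

text \<open>Splitting off the first entry gives a recursion in \<open>M\<close>. With the weight
  \<open>y ^ M\<close> the bound 2 reproduces itself, because the geometric tail from
  \<open>n0\<close> is at most 1/2 and \<open>1 + 2 * (1/2) = 2\<close>.\<close>

lemma card_bounded_lists:
  fixes y :: real
  assumes "1 \<le> n0" "0 < y" "y < 1" "y ^ n0 / (1 - y) \<le> 1/2"
  shows "finite (bounded_lists n0 M) \<and> card (bounded_lists n0 M) * y ^ M \<le> 2"
proof (induction M rule: less_induct)
  case (less M)
  let ?U = "\<Union>x\<in>{n0..M}. (#) x ` bounded_lists n0 (M - x)"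
  have IH: "finite (bounded_lists n0 (M - x))" "card (bounded_lists n0 (M - x)) * y ^ (M - x) \<le> 2"
    if "x \<in> {n0..M}" for x using less[of "M - x"] that assms(1) by auto
  have fin: "finite ?U" using IH by auto
  have "card (bounded_lists n0 M) \<le> card (insert [] ?U)"
    using bounded_lists_subset fin by (intro card_mono) auto
  also have "\<dots> \<le> 1 + card ?U" using fin by (simp add: card_insert_if)
  also have "card ?U \<le> (\<Sum>x\<in>{n0..M}. card ((#) x ` bounded_lists n0 (M - x)))"
    by (rule card_UN_le) simp
  also have "\<dots> = (\<Sum>x\<in>{n0..M}. card (bounded_lists n0 (M - x)))"
    by (intro sum.cong card_image) auto
  finally have "real (card (bounded_lists n0 M)) \<le> 1 + (\<Sum>x\<in>{n0..M}. real (card (bounded_lists n0 (M - x))))"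
    by (simp flip: of_nat_sum of_nat_Suc)
  then have "card (bounded_lists n0 M) * y ^ M
      \<le> (1 + (\<Sum>x\<in>{n0..M}. real (card (bounded_lists n0 (M - x))))) * y ^ M"
    using assms by (intro mult_right_mono) auto
  also have "\<dots> = y ^ M + (\<Sum>x\<in>{n0..M}. real (card (bounded_lists n0 (M - x))) * y ^ (M - x) * y ^ x)"
    by (auto simp: distrib_right sum_distrib_right mult.assoc simp flip: power_add intro!: sum.cong)
  also have "\<dots> \<le> 1 + (\<Sum>x\<in>{n0..M}. 2 * y ^ x)"
    using assms IH by (intro add_mono sum_mono mult_right_mono power_le_one) auto
  also have "\<dots> = 1 + 2 * (\<Sum>x=n0..M. y ^ x)" by (simp add: sum_distrib_left)
  also have "(\<Sum>x=n0..M. y ^ x) \<le> y ^ n0 / (1 - y)"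
    using assms by (auto simp: sum_gp divide_right_mono)
  also note assms(4)
  finally have "card (bounded_lists n0 M) * y ^ M \<le> 2" by simp
  moreover have "finite (bounded_lists n0 M)"
    by (rule finite_subset[OF bounded_lists_subset]) (use fin in simp)
  ultimately show ?case by simp
qed

lemma eventually_card_bounded_lists:
  "\<exists>N\<ge>1. \<forall>n0\<ge>N. \<forall>h. finite (bounded_lists n0 (16 * h)) \<and> card (bounded_lists n0 (16 * h)) \<le> 2 * (2::real) ^ h"
proof -
  \<comment> \<open>Chosen so that \<open>y ^ (16 * h)\<close> is \<open>(1/2) ^ h\<close>.\<close>
  define y :: real where "y = root 16 (1/2)"
  have y: "0 < y" "y < 1" "y ^ 16 = 1/2" by (auto simp: y_def)
  have "(\<lambda>n. y ^ n / (1 - y)) \<longlonglongrightarrow> 0 / (1 - y)"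
    using y by (intro tendsto_intros LIMSEQ_realpow_zero) auto
  then have "eventually (\<lambda>n. y ^ n / (1 - y) < 1/2) sequentially"
    by (rule order_tendstoD) simp
  then obtain N where N: "\<And>n. n \<ge> N \<Longrightarrow> y ^ n / (1 - y) < 1/2"
    by (auto simp: eventually_sequentially)
  show ?thesis
  proof (intro exI[of _ "max N 1"] conjI allI impI)
    fix n0 h :: nat assume "max N 1 \<le> n0"
    then have *: "finite (bounded_lists n0 (16 * h))" "card (bounded_lists n0 (16 * h)) * y ^ (16 * h) \<le> 2"
      using card_bounded_lists[of n0 y "16 * h"] y N[of n0] by auto
    then show "finite (bounded_lists n0 (16 * h))" by simp
    show "card (bounded_lists n0 (16 * h)) \<le> 2 * (2::real) ^ h"
      using *(2) unfolding power_mult y(3) by (simp add: power_divide divide_le_eq)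
  qed simp
qed

section \<open>Union bound over coincidences, and summability\<close>

definition coincidences :: "nat \<Rightarrow> nat \<Rightarrow> nat \<Rightarrow> (nat \<Rightarrow> letter list) set" where
  "coincidences d n0 m = (\<Union>(i, ms) \<in> {8 * (m div 64)..m} \<times>
      {ms \<in> bounded_lists n0 (16 * (m div 64)). set ms \<subseteq> {..8 * (m div 64)}}.
      coincidence d (m div 64) i (m - i) ms)"

lemma sets_coincidences:
  assumes "finite (bounded_lists n0 (16 * (m div 64)))"
  shows "coincidences d n0 m \<in> sets (rw_space \<mu>)"
  unfolding coincidences_def using assms by (intro sets.finite_UN) (auto intro: sets_coincidence)

text \<open>The \<open>2 * 2 ^ h\<close> lists against the factor \<open>(1/3) ^ h\<close> leave
  \<open>(2/3) ^ h\<close>; summing \<open>(3/5) ^ (m - i)\<close> over the starting times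
  contributes at most 5/2.\<close>

lemma measure_coincidences_le:
  assumes "d > 4" "finite (bounded_lists n0 (16 * (m div 64)))"
    "card (bounded_lists n0 (16 * (m div 64))) \<le> 2 * (2::real) ^ (m div 64)"
  shows "measure (rw_space (mu_free d)) (coincidences d n0 m) \<le> 5 * (2/3) ^ (m div 64)"
proof -
  interpret prob_space "rw_space (mu_free d)" by (rule prob_space_rw_space)
  define h where "h = m div 64"
  let ?L = "{ms \<in> bounded_lists n0 (16 * h). set ms \<subseteq> {..8 * h}}"
  have fin: "finite ?L" using assms(2) by (simp add: h_def)
  have "card ?L \<le> card (bounded_lists n0 (16 * h))"
    using assms(2) by (intro card_mono) (auto simp: h_def)
  then have L: "card ?L \<le> 2 * (2::real) ^ h" using assms(3) by (simp add: h_def)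
  have "prob (coincidences d n0 m)
      \<le> (\<Sum>p\<in>{8 * h..m} \<times> ?L. prob (case p of (i, ms) \<Rightarrow> coincidence d h i (m - i) ms))"
    unfolding coincidences_def h_def[symmetric] using fin
    by (intro finite_measure_subadditive_finite) (auto intro: sets_coincidence)
  also have "\<dots> \<le> (\<Sum>p\<in>{8 * h..m} \<times> ?L. (3/5) ^ (m - fst p) * (1/3) ^ h)"
  proof (intro sum_mono)
    fix p assume p: "p \<in> {8 * h..m} \<times> ?L"
    then have "set (snd p) \<subseteq> {..fst p}" by auto
    then show "prob (case p of (i, ms) \<Rightarrow> coincidence d h i (m - i) ms)
        \<le> (3/5) ^ (m - fst p) * (1/3) ^ h"
      using measure_coincidence_le[OF assms(1)] by (auto simp: split_beta)
  qed
  also have "\<dots> = (\<Sum>i=8 * h..m. (3/5) ^ (m - i)) * (card ?L * (1/3) ^ h)"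
    by (simp add: sum.cartesian_product' sum_distrib_right sum_distrib_left mult_ac)
  also have "\<dots> \<le> 5/2 * (2 * 2 ^ h * (1/3) ^ h)"
  proof (intro mult_mono mult_right_mono L)
    have "(\<Sum>i=8 * h..m. (3/5::real) ^ (m - i)) = (\<Sum>j\<in>(\<lambda>i. m - i) ` {8 * h..m}. (3/5) ^ j)"
      by (subst sum.reindex) (auto simp: inj_on_def)
    also have "\<dots> \<le> (\<Sum>j\<le>m. (3/5) ^ j)" by (intro sum_mono2) auto
    also have "\<dots> \<le> 5/2" by (simp add: sum_gp0)
    finally show "(\<Sum>i=8 * h..m. (3/5::real) ^ (m - i)) \<le> 5/2" .
  qed auto
  also have "\<dots> = 5 * (2/3) ^ h" by (simp add: power_divide)
  finally show ?thesis by (simp add: h_def)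
qed

lemma summable_bad_bound: "summable (\<lambda>m. (4/5) ^ m + 5 * (2/3::real) ^ (m div 64))"
proof -
  \<comment> \<open>Rounding in \<open>m div 64\<close> loses fewer than 64 factors
    \<open>y\<close>, which the constant 3/2, the inverse of \<open>y ^ 64\<close>, makes up
    for.\<close>
  define y :: real where "y = root 64 (2/3)"
  have y: "0 < y" "y < 1" "y ^ 64 = 2/3" by (auto simp: y_def)
  have "summable (\<lambda>m. (2/3::real) ^ (m div 64))"
  proof (rule summable_comparison_test')
    show "summable (\<lambda>m. 3/2 * y ^ m)" using y by (intro summable_mult summable_geometric) auto
    fix m :: nat
    have "y ^ (64 * (m div 64) + 64) \<le> y ^ m"
      using y by (intro power_decreasing) auto
    then show "norm ((2/3::real) ^ (m div 64)) \<le> 3/2 * y ^ m"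
      unfolding power_add power_mult y(3) by simp
  qed
  then show ?thesis by (intro summable_add summable_mult summable_geometric) auto
qed

lemma AE_steps_in_support: "AE \<omega> in rw_space \<mu>. \<forall>i. \<omega> i \<in> set_pmf \<mu>"
proof -
  have "AE \<omega> in rw_space \<mu>. \<omega> i \<in> set_pmf \<mu>" for i
    unfolding rw_space_def
    by (rule AE_PiM_component) (auto intro: prob_space_measure_pmf AE_measure_pmf)
  then show ?thesis by (simp add: AE_all_countable)
qed

section \<open>Good paths have positive probability\<close>

theorem mainTheorem11:
  fixes d :: nat
  assumes "d > 4"
  shows "\<not> alg_recurrent (free_group d) (mu_free d)"
proof
  assume rec: "alg_recurrent (free_group d) (mu_free d)"
  let ?M = "rw_space (mu_free d)" and ?b = "\<lambda>m. (4/5) ^ m + 5 * (2/3::real) ^ (m div 64)"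
  interpret prob_space ?M by (rule prob_space_rw_space)
  obtain N1 where N1: "N1 \<ge> 1" "\<And>n0 h. n0 \<ge> N1 \<Longrightarrow> finite (bounded_lists n0 (16 * h))"
    "\<And>n0 h. n0 \<ge> N1 \<Longrightarrow> card (bounded_lists n0 (16 * h)) \<le> 2 * (2::real) ^ h"
    using eventually_card_bounded_lists by blast
  obtain N2 where N2: "\<And>n. n \<ge> N2 \<Longrightarrow> norm (\<Sum>k. ?b (k + n)) < 1"
    using suminf_exist_split[OF zero_less_one summable_bad_bound] by blast
  \<comment> \<open>Beyond \<open>N1\<close> the count of lists holds; beyond \<open>N2\<close> the
    tail of the series of bad probabilities is below 1.\<close>
  define n0 where "n0 = max N1 N2"
  have n0: "n0 \<ge> N1" "n0 \<ge> 1" using N1 by (auto simp: n0_def)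
  define Bad where "Bad k = slow_escape d (k + n0) \<union> coincidences d n0 (k + n0)" for k
  have sets: "Bad k \<in> sets ?M" for k
    unfolding Bad_def using N1(2)[OF n0(1)] by (intro sets.Un sets_slow_escape sets_coincidences)
  have le: "prob (Bad k) \<le> ?b (k + n0)" for k
  proof -
    have "prob (Bad k) \<le> prob (slow_escape d (k + n0)) + prob (coincidences d n0 (k + n0))"
      unfolding Bad_def using N1(2)[OF n0(1)]
      by (intro measure_Un_le sets_slow_escape sets_coincidences)
    also have "\<dots> \<le> ?b (k + n0)"
      using N1(2,3)[OF n0(1)] assms
      by (intro add_mono measure_slow_escape_le measure_coincidences_le)
    finally show ?thesis .
  qed
  have sum: "summable (\<lambda>k. ?b (k + n0))" using summable_bad_bound by (rule summable_ignore_initial_segment)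
  have sumBad: "summable (\<lambda>k. prob (Bad k))"
    by (rule summable_comparison_test'[OF sum]) (use le in auto)
  have "prob (\<Union>k. Bad k) \<le> (\<Sum>k. prob (Bad k))"
    using sets sumBad by (intro finite_measure_subadditive_countably) auto
  also have "\<dots> \<le> (\<Sum>k. ?b (k + n0))" by (intro suminf_le le sumBad sum)
  also have "\<dots> < 1" using N2[of n0] by (simp add: n0_def)
  finally have lt: "prob (\<Union>k. Bad k) < 1" .
  have "AE \<omega> in ?M. rw_tail_semigroup (free_group d) \<omega> (64 * n0) = carrier (free_group d)"
    using rec n0 by (auto simp: alg_recurrent_def)
  \<comment> \<open>A path of letters outside every \<open>Bad k\<close> is a
    \<open>good_path\<close>, so its tail semigroup misses the identity; recurrence would thus put
    almost every path into the union, whose probability is below 1.\<close>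
  then have "AE \<omega> in ?M. \<omega> \<in> (\<Union>k. Bad k)"
    using AE_steps_in_support[of "mu_free d"]
  proof eventually_elim
    case (elim \<omega>)
    show ?case
    proof (rule ccontr)
      assume nb: "\<omega> \<notin> (\<Union>k. Bad k)"
      have good: "\<omega> \<notin> slow_escape d m" "\<omega> \<notin> coincidences d n0 m" if "n0 \<le> m" for m
      proof -
        have "\<omega> \<notin> Bad (m - n0)" using nb by blast
        then show "\<omega> \<notin> slow_escape d m" "\<omega> \<notin> coincidences d n0 m"
          using that by (auto simp: Bad_def)
      qed
      interpret good_path d \<omega> n0
      proof
        show "\<exists>a. \<omega> i = [a]" for i
        proof -
          have "\<omega> i \<in> (\<lambda>p. [p]) ` ({..<d} \<times> UNIV)"
            using elim(2) assms by (simp add: set_pmf_mu_free)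
          then show ?thesis by blast
        qed
        show "i \<le> 4 * length (rw_pos (free_group d) \<omega> i)" if "n0 \<le> i" for i
          using good(1)[OF that] by (simp add: slow_escape_def)
        show "rw_pos (free_group d) (\<lambda>j. \<omega> (i + j)) (m - i) \<noteq>
            word_inv (take (m div 64) (walk_prod d \<omega> ms))"
          if "64 * n0 \<le> m" "i \<in> {8 * (m div 64)..m}" "set ms \<subseteq> {n0..8 * (m div 64)}"
            "sum_list ms \<le> 16 * (m div 64)" "m div 64 \<le> length (walk_prod d \<omega> ms)" for m i ms
        proof -
          have "(i, ms) \<in> {8 * (m div 64)..m} \<times>
              {ms \<in> bounded_lists n0 (16 * (m div 64)). set ms \<subseteq> {..8 * (m div 64)}}"
            using that by (auto simp: bounded_lists_def)
          then have "\<omega> \<notin> coincidence d (m div 64) i (m - i) ms"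
            using good(2)[of m] that(1) by (auto simp: coincidences_def)
          then show ?thesis using that(5) by (simp add: coincidence_def)
        qed
      qed
      have "[] \<in> carrier (free_group d)" by (simp add: free_group_def)
      then show False using Nil_notin_tail_semigroup elim(1) by simp
    qed
  qed
  moreover have "(\<Union>k. Bad k) \<in> events" using sets by blast
  ultimately have "prob (\<Union>k. Bad k) = 1" using prob_eq_1 by blast
  with lt show False by simp
qed

end
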